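(* Let $n,m\ge 1$ be integers and let $n_\theta = n\left(\frac{3n+1}{2}+2m\right)+m^2$. Let $\theta\in\mathbb{R}^{n_\theta}$ be a parameter vector partitioned as $\theta=[\theta_E^{\mathsf T},\theta_J^{\mathsf T},\theta_W^{\mathsf T},\theta_B^{\mathsf T},\theta_N^{\mathsf T}]^{\mathsf T}$ with $\theta_E\in\mathbb{R}^{n(n+1)/2}$, $\theta_J\in\mathbb{R}^{n(n-1)/2}$, $\theta_W\in\mathbb{R}^{(n+m)(n+m+1)/2}$, $\theta_B\in\mathbb{R}^{n\cdot m}$, $\theta_N\in\mathbb{R}^{m(m-1)/2}$. Define $$E(\theta):=\mathrm{vtu}(\theta_E)^{\mathsf T}\mathrm{vtu}(\theta_E),\quad J(\theta):=\mathrm{vtsu}(\theta_J)^{\mathsf T}-\mathrm{vtsu}(\theta_J),\quad W(\theta):=\mathrm{vtu}(\theta_W)^{\mathsf T}\mathrm{vtu}(\theta_W),$$ $$B(\theta):=\mathrm{vtf}_m(\theta_B),\quad N(\theta):=\mathrm{vtsu}(\theta_N)^{\mathsf T}-\mathrm{vtsu}(\theta_N),$$ $$R(\theta):=\begin{bmatrix}I_n&0\end{bmatrix}W(\theta)\begin{bmatrix}I_n&0\end{bmatrix}^{\mathsf T},\quad P(\theta):=\begin{bmatrix}I_n&0\end{bmatrix}W(\theta)\begin{bmatrix}0&I_m\end{bmatrix}^{\mathsf T},\quad S(\theta):=\begin{bmatrix}0&I_m\end{bmatrix}W(\theta)\begin{bmatrix}0&I_m\end{bmatrix}^{\mathsf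 T}.$$ Then the parametric system $$\Sigma_{\mathsf{pH}}(\theta):\ \begin{cases}E(\theta)\dot x(t)=(J(\theta)-R(\theta))x(t)+(B(\theta)-P(\theta))u(t),\\ y(t)=(B(\theta)+P(\theta))^{\mathsf T}x(t)+(S(\theta)+N(\theta))u(t)\end{cases}$$ satisfies the port-Hamiltonian structural constraints. Conversely, for any port-Hamiltonian system $\Sigma_{\mathsf{pH}}$ with $n$ states and $m$ inputs and outputs, there is a vector $\theta\in\mathbb{R}^{n_\theta}$ such that $\Sigma_{\mathsf{pH}}=\Sigma_{\mathsf{pH}}(\theta)$ (i.e. the matrices $E,J,R,B,P,S,N$ of $\Sigma_{\mathsf{pH}}$ equal $E(\theta),J(\theta),R(\theta),B(\theta),P(\theta),S(\theta),N(\theta)$).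
   Context: Port-Hamiltonian system: a linear time-invariant system $E\dot x(t)=(J-R)x(t)+(B-P)u(t)$, $y(t)=(B+P)^{\mathsf T}x(t)+(S+N)u(t)$ with $E,J,R\in\mathbb{R}^{n\times n}$, $B,P\in\mathbb{R}^{n\times m}$, $S,N\in\mathbb{R}^{m\times m}$ is called port-Hamiltonian (with $n$ states and $m$ inputs and outputs) if it satisfies the structural constraints $E\ge 0$, $J=-J^{\mathsf T}$, $N=-N^{\mathsf T}$, and $W:=\begin{bmatrix}R&P\\P^{\mathsf T}&S\end{bmatrix}\ge 0$. Here $\ge 0$ means symmetric positive semi-definite. Reshaping functions: $\mathrm{vtf}_m$ maps a vector $v$ of length $k m$ to the $k\times m$ matrix obtained by filling columns in order (entry $(i,j)$ is $v_{(j-1)k+i}$). $\mathrm{vtu}$ maps a vector of length $k(k+1)/2$ to the $k\times k$ upper triangular matrix whose upper triangular part (including the diagonal) is filled row by row: first row $v_1,\dots,v_k$; second row $0,v_{k+1},\dots,v_{2k-1}$; and so on. $\mathrm{vtsu}$ maps a vector of length $k(k-1)/2$ to the $k\times k$ strictly upper triangular matrix whose strictly upper triangular part is filled row by row: first row $0,v_1,\dots,v_{k-1}$; second row $0,0,v_k,\dots,v_{2k-3}$; and so on. $I_k$ is the $k\times k$ identity matrix. *)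

theory Defs
  imports Complex_Main "Jordan_Normal_Form.Matrix"
begin

text \<open>Indices are 0-based throughout: entry \<open>(i, j)\<close> below is entry \<open>(i + 1, j + 1)\<close> in
  1-based notation.\<close>

definition symmetric_psd :: "nat \<Rightarrow> real mat \<Rightarrow> bool" where
  "symmetric_psd k A \<longleftrightarrow> A \<in> carrier_mat k k \<and> A\<^sup>T = A \<and>
     (\<forall>v \<in> carrier_vec k. v \<bullet> (A *\<^sub>v v) \<ge> 0)"

text \<open>The coefficients of the system
  \<open>E x'(t) = (J - R) x(t) + (B - P) u(t)\<close>, \<open>y(t) = (B + P)\<^sup>T x(t) + (S + N) u(t)\<close>.
  Two systems are equal iff all seven coefficient matrices agree.\<close>

record system =
  sys_E :: "real mat"
  sys_J :: "real mat"
  sys_R :: "real mat"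
  sys_B :: "real mat"
  sys_P :: "real mat"
  sys_S :: "real mat"
  sys_N :: "real mat"

definition sys_W :: "system \<Rightarrow> real mat" where
  "sys_W \<Sigma> = four_block_mat (sys_R \<Sigma>) (sys_P \<Sigma>) ((sys_P \<Sigma>)\<^sup>T) (sys_S \<Sigma>)"

definition port_Hamiltonian :: "nat \<Rightarrow> nat \<Rightarrow> system \<Rightarrow> bool" where
  "port_Hamiltonian n m \<Sigma> \<longleftrightarrow>
     sys_E \<Sigma> \<in> carrier_mat n n \<and> sys_J \<Sigma> \<in> carrier_mat n n \<and> sys_R \<Sigma> \<in> carrier_mat n n \<and>
     sys_B \<Sigma> \<in> carrier_mat n m \<and> sys_P \<Sigma> \<in> carrier_mat n m \<and>
     sys_S \<Sigma> \<in> carrier_mat m m \<and> sys_N \<Sigma> \<in> carrier_mat m m \<and>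
     symmetric_psd n (sys_E \<Sigma>) \<and>
     sys_J \<Sigma> = - (sys_J \<Sigma>)\<^sup>T \<and>
     sys_N \<Sigma> = - (sys_N \<Sigma>)\<^sup>T \<and>
     symmetric_psd (n + m) (sys_W \<Sigma>)"

definition vtf :: "nat \<Rightarrow> real vec \<Rightarrow> real mat" where
  "vtf m v = (let k = dim_vec v div m in mat k m (\<lambda>(i, j). v $ (j * k + i)))"

text \<open>The size \<open>k\<close> of the triangular matrices, which is determined by the length
  \<open>k (k + 1) / 2\<close> resp. \<open>k (k - 1) / 2\<close> of the vector, is passed explicitly. The sums below
  count the entries used up by the rows above row \<open>i\<close>: row \<open>r\<close> has \<open>k - r\<close> entries
  in the upper triangle and \<open>k - 1 - r\<close> in the strictly upper triangle.\<close>

definition vtu :: "nat \<Rightarrow> real vec \<Rightarrow> real mat" where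
  "vtu k v = mat k k (\<lambda>(i, j). if i \<le> j then v $ ((\<Sum>r<i. k - r) + (j - i)) else 0)"

definition vtsu :: "nat \<Rightarrow> real vec \<Rightarrow> real mat" where
  "vtsu k v = mat k k (\<lambda>(i, j). if i < j then v $ ((\<Sum>r<i. k - 1 - r) + (j - i - 1)) else 0)"

definition append_cols :: "real mat \<Rightarrow> real mat \<Rightarrow> real mat" (infixr \<open>@\<^sub>c\<close> 65) where
  "A @\<^sub>c B = four_block_mat A B (0\<^sub>m 0 (dim_col A)) (0\<^sub>m 0 (dim_col B))"

definition slice :: "real vec \<Rightarrow> nat \<Rightarrow> nat \<Rightarrow> real vec" where
  "slice v off len = vec len (\<lambda>i. v $ (off + i))"

definition len_E :: "nat \<Rightarrow> nat" where "len_E n = n * (n + 1) div 2"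
definition len_J :: "nat \<Rightarrow> nat" where "len_J n = n * (n - 1) div 2"
definition len_W :: "nat \<Rightarrow> nat \<Rightarrow> nat" where "len_W n m = (n + m) * (n + m + 1) div 2"
definition len_B :: "nat \<Rightarrow> nat \<Rightarrow> nat" where "len_B n m = n * m"
definition len_N :: "nat \<Rightarrow> nat" where "len_N m = m * (m - 1) div 2"

definition n_theta :: "nat \<Rightarrow> nat \<Rightarrow> nat" where
  "n_theta n m = n * (3 * n + 1) div 2 + 2 * n * m + m\<^sup>2"

definition theta_E :: "nat \<Rightarrow> nat \<Rightarrow> real vec \<Rightarrow> real vec" where
  "theta_E n m \<theta> = slice \<theta> 0 (len_E n)"

definition theta_J :: "nat \<Rightarrow> nat \<Rightarrow> real vec \<Rightarrow> real vec" where
  "theta_J n m \<theta> = slice \<theta> (len_E n) (len_J n)"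

definition theta_W :: "nat \<Rightarrow> nat \<Rightarrow> real vec \<Rightarrow> real vec" where
  "theta_W n m \<theta> = slice \<theta> (len_E n + len_J n) (len_W n m)"

definition theta_B :: "nat \<Rightarrow> nat \<Rightarrow> real vec \<Rightarrow> real vec" where
  "theta_B n m \<theta> = slice \<theta> (len_E n + len_J n + len_W n m) (len_B n m)"

definition theta_N :: "nat \<Rightarrow> nat \<Rightarrow> real vec \<Rightarrow> real vec" where
  "theta_N n m \<theta> = slice \<theta> (len_E n + len_J n + len_W n m + len_B n m) (len_N m)"

lemma len_E_add_J: "len_E n + len_J n = n\<^sup>2"
proof (cases n)
  case (Suc k)
  have "even (k * (k + 1))" "even (n * (n + 1))" by simp_all
  then have "2 * (len_E n + len_J n) = n * (n + 1) + (k + 1) * k"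
    unfolding len_E_def len_J_def Suc by (simp add: mult.commute)
  also have "\<dots> = 2 * n\<^sup>2" by (simp add: Suc power2_eq_square)
  finally show ?thesis by simp
qed (simp add: len_E_def len_J_def)

lemma n_theta_partition:
  "n_theta n m = len_E n + len_J n + len_W n m + len_B n m + len_N m"
proof -
  have N: "2 * len_N m + m = m\<^sup>2"
    unfolding len_N_def by (cases m) (simp_all add: power2_eq_square)
  have "2 * len_W n m = (n + m) * (n + m + 1)" unfolding len_W_def by simp
  moreover have "even (n * (3 * n + 1))" by simp
  then have "2 * n_theta n m = n * (3 * n + 1) + 4 * n * m + 2 * m\<^sup>2"
    unfolding n_theta_def by (simp add: algebra_simps)
  ultimately have "2 * n_theta n m =
      2 * (len_E n + len_J n + len_W n m + len_B n m + len_N m)"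
    using N unfolding len_E_add_J len_B_def
    by (simp add: algebra_simps power2_eq_square)
  then show ?thesis by simp
qed

lemma n_theta_real:
  "real (n_theta n m) = real n * ((3 * real n + 1) / 2 + 2 * real m) + (real m)\<^sup>2"
proof -
  have "real (n * (3 * n + 1) div 2) = real n * (3 * real n + 1) / 2"
    by (subst real_of_nat_div) (simp_all add: algebra_simps)
  then show ?thesis
    unfolding n_theta_def by (simp add: algebra_simps add_divide_distrib)
qed

lemma theta_partition:
  assumes "\<theta> \<in> carrier_vec (n_theta n m)"
  shows "\<theta> = theta_E n m \<theta> @\<^sub>v theta_J n m \<theta> @\<^sub>v theta_W n m \<theta> @\<^sub>v theta_B n m \<theta> @\<^sub>v theta_N n m \<theta>"
  by (rule eq_vecI) (use assms in \<open>auto simp: n_theta_partition theta_E_def theta_J_def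
      theta_W_def theta_B_def theta_N_def slice_def\<close>)

definition E_of :: "nat \<Rightarrow> nat \<Rightarrow> real vec \<Rightarrow> real mat" where
  "E_of n m \<theta> = (vtu n (theta_E n m \<theta>))\<^sup>T * vtu n (theta_E n m \<theta>)"

definition J_of :: "nat \<Rightarrow> nat \<Rightarrow> real vec \<Rightarrow> real mat" where
  "J_of n m \<theta> = (vtsu n (theta_J n m \<theta>))\<^sup>T - vtsu n (theta_J n m \<theta>)"

definition W_of :: "nat \<Rightarrow> nat \<Rightarrow> real vec \<Rightarrow> real mat" where
  "W_of n m \<theta> = (vtu (n + m) (theta_W n m \<theta>))\<^sup>T * vtu (n + m) (theta_W n m \<theta>)"

definition B_of :: "nat \<Rightarrow> nat \<Rightarrow> real vec \<Rightarrow> real mat" where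
  "B_of n m \<theta> = vtf m (theta_B n m \<theta>)"

definition N_of :: "nat \<Rightarrow> nat \<Rightarrow> real vec \<Rightarrow> real mat" where
  "N_of n m \<theta> = (vtsu m (theta_N n m \<theta>))\<^sup>T - vtsu m (theta_N n m \<theta>)"

definition R_of :: "nat \<Rightarrow> nat \<Rightarrow> real vec \<Rightarrow> real mat" where
  "R_of n m \<theta> = (1\<^sub>m n @\<^sub>c 0\<^sub>m n m) * W_of n m \<theta> * (1\<^sub>m n @\<^sub>c 0\<^sub>m n m)\<^sup>T"

definition P_of :: "nat \<Rightarrow> nat \<Rightarrow> real vec \<Rightarrow> real mat" where
  "P_of n m \<theta> = (1\<^sub>m n @\<^sub>c 0\<^sub>m n m) * W_of n m \<theta> * (0\<^sub>m m n @\<^sub>c 1\<^sub>m m)\<^sup>T"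

definition S_of :: "nat \<Rightarrow> nat \<Rightarrow> real vec \<Rightarrow> real mat" where
  "S_of n m \<theta> = (0\<^sub>m m n @\<^sub>c 1\<^sub>m m) * W_of n m \<theta> * (0\<^sub>m m n @\<^sub>c 1\<^sub>m m)\<^sup>T"

definition Sigma_pH :: "nat \<Rightarrow> nat \<Rightarrow> real vec \<Rightarrow> system" where
  "Sigma_pH n m \<theta> =
     \<lparr> sys_E = E_of n m \<theta>, sys_J = J_of n m \<theta>, sys_R = R_of n m \<theta>, sys_B = B_of n m \<theta>,
       sys_P = P_of n m \<theta>, sys_S = S_of n m \<theta>, sys_N = N_of n m \<theta> \<rparr>"

end

theory Submission
  imports Defs
begin

text \<open>The only part of the converse that is not bookkeeping is that every positive semi-definite
  matrix, singular or not, is \<open>U\<^sup>T U\<close> with \<open>U\<close> upper triangular. The usual Cholesky recursion by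
  Schur complements of the top left entry \<open>a\<close> still works: if \<open>a = 0\<close>, then semi-definiteness
  forces the whole first row to vanish.\<close>

section \<open>Cholesky factorisation of positive semi-definite matrices\<close>

text \<open>Splits off index 0. The mixed sums over the first row and over the first column coincide
  by \<open>sym\<close>, hence the factor 2.\<close>

lemma quadratic_form_Suc:
  fixes A :: "nat \<Rightarrow> nat \<Rightarrow> real"
  assumes sym: "\<And>j. j < k \<Longrightarrow> A (Suc j) 0 = A 0 (Suc j)"
  shows "(\<Sum>i<Suc k. \<Sum>j<Suc k. x i * A i j * x j) =
    A 0 0 * (x 0)\<^sup>2 + 2 * x 0 * (\<Sum>j<k. A 0 (Suc j) * x (Suc j)) +
    (\<Sum>i<k. \<Sum>j<k. x (Suc i) * A (Suc i) (Suc j) * x (Suc j))"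
proof -
  have "(\<Sum>i<k. x (Suc i) * A (Suc i) 0 * x 0) = x 0 * (\<Sum>j<k. A 0 (Suc j) * x (Suc j))"
    unfolding sum_distrib_left by (rule sum.cong) (auto simp: sym)
  moreover have "(\<Sum>j<k. x 0 * A 0 (Suc j) * x (Suc j)) = x 0 * (\<Sum>j<k. A 0 (Suc j) * x (Suc j))"
    unfolding sum_distrib_left by (rule sum.cong) auto
  ultimately show ?thesis
    by (simp add: sum.lessThan_Suc_shift sum.distrib power2_eq_square algebra_simps
        del: sum.lessThan_Suc)
qed

text \<open>The subtracted matrix is the outer product of \<open>w\<close> with itself over
  \<open>a\<close>, so its form is a square over \<open>a\<close>. This computes the form of the
  Schur complement; for \<open>a = 0\<close> both quotients are 0.\<close>

lemma quadratic_form_rank_one_update: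
  fixes C :: "nat \<Rightarrow> nat \<Rightarrow> real"
  shows "(\<Sum>i<k. \<Sum>j<k. y i * (C i j - w i * w j / a) * y j) =
    (\<Sum>i<k. \<Sum>j<k. y i * C i j * y j) - (\<Sum>j<k. w j * y j)\<^sup>2 / a"
proof -
  have "(\<Sum>j<k. w j * y j)\<^sup>2 / a = (\<Sum>i<k. \<Sum>j<k. y i * (w i * w j / a) * y j)"
    unfolding power2_eq_square sum_product sum_divide_distrib
    by (intro sum.cong) (auto simp: mult_ac)
  then show ?thesis
    by (simp add: sum_subtractf[symmetric] algebra_simps)
qed

text \<open>Serves the singular case \<open>a = 0\<close>, where the quadratic form is affine in the
  coordinate at index 0.\<close>

lemma linear_nonneg_imp_zero:
  fixes b c :: real
  assumes "\<And>t. 0 \<le> 2 * t * b + c"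
  shows "b = 0"
proof (rule ccontr)
  assume "b \<noteq> 0"
  \<comment> \<open>At this \<open>t\<close> the affine expression takes the value -1.\<close>
  then show False using assms[of "- (c + 1) / (2 * b)"] by (simp add: field_simps)
qed

text \<open>Stated for functions on indices, so that deleting the first row and column is just a
  shift by \<open>Suc\<close> in the induction on \<open>k\<close>.\<close>

lemma cholesky_psd_fun:
  fixes A :: "nat \<Rightarrow> nat \<Rightarrow> real"
  assumes "\<And>i j. i < k \<Longrightarrow> j < k \<Longrightarrow> A i j = A j i"
    and "\<And>x. 0 \<le> (\<Sum>i<k. \<Sum>j<k. x i * A i j * x j)"
  shows "\<exists>U. (\<forall>i j. j < i \<longrightarrow> U i j = 0) \<and>
    (\<forall>i<k. \<forall>j<k. A i j = (\<Sum>l<k. U l i * U l j))"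
  using assms
proof (induction k arbitrary: A)
  case 0
  show ?case by (intro exI[of _ "\<lambda>_ _. 0"]) simp
next
  case (Suc k)
  define a where "a = A 0 0"
  define w where "w j = A 0 (Suc j)" for j
  define C where "C i j = A (Suc i) (Suc j)" for i j
  have w_sym: "A (Suc j) 0 = w j" if "j < k" for j
    using Suc.prems(1)[of "Suc j" 0] that by (simp add: w_def)
  \<comment> \<open>The form at the vector with head \<open>t\<close> and tail \<open>y\<close>; the
    steps below differ only in their choice of these two.\<close>
  have Q: "0 \<le> a * t\<^sup>2 + 2 * t * (\<Sum>j<k. w j * y j) + (\<Sum>i<k. \<Sum>j<k. y i * C i j * y j)"
    for t y
    using Suc.prems(2)[of "case_nat t y"] quadratic_form_Suc[of k A "case_nat t y"]
    by (simp add: w_sym a_def w_def[symmetric] C_def del: sum.lessThan_Suc)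
  have a_nonneg: "0 \<le> a" using Q[of 1 "\<lambda>_. 0"] by simp
  \<comment> \<open>With the \<open>j\<close>-th unit vector as tail and \<open>a = 0\<close>, the
    form is affine in \<open>t\<close> with slope \<open>2 * w j\<close>.\<close>
  have w_zero: "w j = 0" if "a = 0" "j < k" for j
  proof (rule linear_nonneg_imp_zero)
    fix t
    show "0 \<le> 2 * t * w j + C j j"
      using Q[of t "\<lambda>i. if i = j then 1 else 0"] that
      by (simp add: if_distrib[of "\<lambda>x. x * z" for z] if_distrib[of "\<lambda>x. z * x" for z]
        cong: if_cong)
  qed
  have "\<exists>U. (\<forall>i j. j < i \<longrightarrow> U i j = 0) \<and>
      (\<forall>i<k. \<forall>j<k. C i j - w i * w j / a = (\<Sum>l<k. U l i * U l j))"
  proof (rule Suc.IH)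
    show "C i j - w i * w j / a = C j i - w j * w i / a" if "i < k" "j < k" for i j
      using Suc.prems(1)[of "Suc i" "Suc j"] that by (simp add: C_def)
  next
    fix y :: "nat \<Rightarrow> real"
    show "0 \<le> (\<Sum>i<k. \<Sum>j<k. y i * (C i j - w i * w j / a) * y j)"
      unfolding quadratic_form_rank_one_update
      \<comment> \<open>For \<open>a > 0\<close> this head minimises the form over \<open>t\<close>,
        and the minimum is the form of the Schur complement. For \<open>a = 0\<close> the head is 0
        and the form of \<open>C\<close> remains.\<close>
      using Q[of "- (\<Sum>j<k. w j * y j) / a" y]
      by (cases "a = 0") (simp_all add: power2_eq_square field_simps)
  qed
  then obtain U where U: "\<And>i j. j < i \<Longrightarrow> U i j = 0"
    and CU: "\<And>i j. i < k \<Longrightarrow> j < k \<Longrightarrow> C i j - w i * w j / a = (\<Sum>l<k. U l i * U l j)"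
    by blast
  \<comment> \<open>For \<open>a = 0\<close> the first row is \<open>0\<close>, by \<open>x / 0 = 0\<close>.\<close>
  define V where "V i j = (case i of 0 \<Rightarrow> (case j of 0 \<Rightarrow> sqrt a | Suc j \<Rightarrow> w j / sqrt a)
      | Suc i \<Rightarrow> (case j of 0 \<Rightarrow> 0 | Suc j \<Rightarrow> U i j))" for i j
  have V_simps [simp]: "V 0 0 = sqrt a" "V 0 (Suc j) = w j / sqrt a"
    "V (Suc i) 0 = 0" "V (Suc i) (Suc j) = U i j" for i j
    by (simp_all add: V_def)
  have "V i j = 0" if "j < i" for i j
    using that U by (cases i; cases j) auto
  moreover have "A i j = (\<Sum>l<Suc k. V l i * V l j)" if "i < Suc k" "j < Suc k" for i j
  proof -
    have sqrt: "sqrt a * sqrt a = a" "sqrt a = 0 \<longleftrightarrow> a = 0" using a_nonneg by simp_all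
    consider "i = 0" "j = 0" | j' where "i = 0" "j = Suc j'" | i' where "i = Suc i'" "j = 0"
      | i' j' where "i = Suc i'" "j = Suc j'"
      by (cases i; cases j) auto
    then show ?thesis
    proof cases
      case 1
      then show ?thesis using sqrt
        by (simp add: sum.lessThan_Suc_shift a_def del: sum.lessThan_Suc)
    next
      \<comment> \<open>The product of \<open>sqrt a\<close> and \<open>w j' / sqrt a\<close> is
        \<open>w j'\<close> if \<open>a\<close> is nonzero; otherwise \<open>w_zero\<close> makes
        both sides 0.\<close>
      case 2
      then show ?thesis using sqrt that w_zero[of j']
        by (simp add: sum.lessThan_Suc_shift w_def[symmetric] del: sum.lessThan_Suc)
    next
      case 3
      then show ?thesis using sqrt that w_zero[of i'] w_sym[of i']
        by (simp add: sum.lessThan_Suc_shift del: sum.lessThan_Suc)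
    next
      \<comment> \<open>The new row contributes \<open>w i' * w j' / a\<close>, exactly what the
        Schur complement in \<open>CU\<close> took away.\<close>
      case 4
      then show ?thesis using sqrt that CU[of i' j']
        by (simp add: sum.lessThan_Suc_shift C_def[symmetric] algebra_simps del: sum.lessThan_Suc)
    qed
  qed
  ultimately show ?case by (intro exI[of _ V]) simp
qed

lemma cholesky_psd:
  assumes "symmetric_psd k A"
  obtains U where "U \<in> carrier_mat k k" "\<And>i j. j < i \<Longrightarrow> i < k \<Longrightarrow> U $$ (i, j) = 0" "A = U\<^sup>T * U"
proof -
  have A: "A \<in> carrier_mat k k" and sym: "A\<^sup>T = A"
    and nonneg: "\<And>v. v \<in> carrier_vec k \<Longrightarrow> 0 \<le> v \<bullet> (A *\<^sub>v v)"
    using assms by (auto simp: symmetric_psd_def)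
  have "\<exists>U. (\<forall>i j. j < i \<longrightarrow> U i j = 0) \<and>
      (\<forall>i<k. \<forall>j<k. A $$ (i, j) = (\<Sum>l<k. U l i * U l j))"
  proof (rule cholesky_psd_fun)
    show "A $$ (i, j) = A $$ (j, i)" if "i < k" "j < k" for i j
      using that A sym by (metis carrier_matD index_transpose_mat(1))
  next
    fix x
    show "0 \<le> (\<Sum>i<k. \<Sum>j<k. x i * A $$ (i, j) * x j)"
      using nonneg[of "vec k x"] A
      by (simp add: scalar_prod_def lessThan_atLeast0 sum_distrib_left mult.assoc)
  qed
  then obtain U where U: "\<And>i j. j < i \<Longrightarrow> U i j = 0"
    and AU: "\<And>i j. i < k \<Longrightarrow> j < k \<Longrightarrow> A $$ (i, j) = (\<Sum>l<k. U l i * U l j)"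
    by blast
  show ?thesis
  proof (rule that)
    show "mat k k (\<lambda>(i, j). U i j) \<in> carrier_mat k k" by simp
    show "mat k k (\<lambda>(i, j). U i j) $$ (i, j) = 0" if "j < i" "i < k" for i j
      using that U by simp
    show "A = (mat k k (\<lambda>(i, j). U i j))\<^sup>T * mat k k (\<lambda>(i, j). U i j)"
      by (rule eq_matI) (use A AU in \<open>auto simp: scalar_prod_def lessThan_atLeast0\<close>)
  qed
qed

section \<open>Gram matrices are positive semi-definite\<close>

lemma transpose_mult_self_carrier [simp]:
  "U \<in> carrier_mat k k \<Longrightarrow> U\<^sup>T * U \<in> carrier_mat k k"
  by (rule mult_carrier_mat) auto

text \<open>Moving the transpose to the other side of the scalar product turns the form at
  \<open>v\<close> into the sum of squares of the entries of \<open>U *\<^sub>v v\<close>.\<close>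

lemma symmetric_psd_transpose_mult_self:
  assumes U: "U \<in> carrier_mat k k"
  shows "symmetric_psd k (U\<^sup>T * U)"
  unfolding symmetric_psd_def
proof (intro conjI ballI)
  show "U\<^sup>T * U \<in> carrier_mat k k" using U by simp
  show "(U\<^sup>T * U)\<^sup>T = U\<^sup>T * U" using U transpose_mult[of "U\<^sup>T" k k U k] by simp
next
  fix v :: "real vec" assume v: "v \<in> carrier_vec k"
  have "v \<bullet> ((U\<^sup>T * U) *\<^sub>v v) = v \<bullet> (U\<^sup>T *\<^sub>v (U *\<^sub>v v))"
    using U v by (simp add: assoc_mult_mat_vec[of _ k k _ k])
  also have "\<dots> = (U *\<^sub>v v) \<bullet> (U *\<^sub>v v)"
    using U v transpose_vec_mult_scalar[of U k k v "U *\<^sub>v v"]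
    by (simp add: comm_scalar_prod[of v k])
  also have "\<dots> \<ge> 0" by (simp add: scalar_prod_def sum_nonneg)
  finally show "0 \<le> v \<bullet> ((U\<^sup>T * U) *\<^sub>v v)" .
qed

section \<open>Surjectivity of the reshaping maps\<close>

text \<open>Positions in a row-by-row listing increase with the row. This gives injectivity of the
  positions and, with \<open>i' = k\<close>, their bound by the total length.\<close>

lemma row_offset_less:
  fixes c :: "nat \<Rightarrow> nat"
  assumes "i < i'" "p < c i"
  shows "(\<Sum>r<i. c r) + p < (\<Sum>r<i'. c r)"
proof -
  have "(\<Sum>r<i. c r) + p < (\<Sum>r<Suc i. c r)" using assms by simp
  also have "\<dots> \<le> (\<Sum>r<i'. c r)" using assms by (intro sum_mono2) auto
  finally show ?thesis .
qed

text \<open>The common core of \<open>vtu\<close> and \<open>vtsu\<close>: a ragged array with row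
  lengths \<open>c\<close> can be stored in one vector. As the position map is injective, the vector
  is defined through its inverse and no formula for that inverse is required.\<close>

lemma rowwise_fill:
  fixes c :: "nat \<Rightarrow> nat" and f :: "nat \<Rightarrow> nat \<Rightarrow> 'a"
  obtains v where "v \<in> carrier_vec (\<Sum>r<k. c r)"
    "\<And>i p. i < k \<Longrightarrow> p < c i \<Longrightarrow> v $ ((\<Sum>r<i. c r) + p) = f i p"
proof -
  define S where "S = (SIGMA i:{..<k}. {..<c i})"
  define pos where "pos = (\<lambda>(i, p). (\<Sum>r<i. c r) + p)"
  have inj: "inj_on pos S"
  proof (rule inj_onI, clarify)
    fix i p i' p' assume S: "(i, p) \<in> S" "(i', p') \<in> S" and eq: "pos (i, p) = pos (i', p')"
    have "i = i'"
    proof (cases i i' rule: linorder_cases)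
      case less
      then show ?thesis using S eq row_offset_less[of i i' p c] by (simp add: S_def pos_def)
    next
      case greater
      then show ?thesis using S eq row_offset_less[of i' i p' c] by (simp add: S_def pos_def)
    qed
    then show "i = i' \<and> p = p'" using eq by (simp add: pos_def)
  qed
  show ?thesis
  proof (rule that)
    let ?v = "vec (\<Sum>r<k. c r) (\<lambda>q. case_prod f (inv_into S pos q))"
    show "?v \<in> carrier_vec (\<Sum>r<k. c r)" by simp
    show "?v $ ((\<Sum>r<i. c r) + p) = f i p" if "i < k" "p < c i" for i p
    proof -
      have "inv_into S pos (pos (i, p)) = (i, p)"
        using that by (intro inv_into_f_f inj) (simp add: S_def)
      then show ?thesis using that row_offset_less[of i k p c] by (simp add: pos_def)
    qed
  qed
qed

text \<open>Reversing the order of summation gives 1 + ... + k. This matches the length from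
  \<open>rowwise_fill\<close> with the one expected by \<open>len_E\<close> and
  \<open>len_W\<close>.\<close>

lemma sum_diff_lessThan: "(\<Sum>r<k. k - r) = k * (k + 1) div (2::nat)"
proof -
  have "(\<Sum>r<k. k - r) = (\<Sum>r<k. Suc r)"
    using sum.nat_diff_reindex[of Suc k] by (simp add: Suc_diff_Suc)
  also have "2 * \<dots> = k * (k + 1)" by (induction k) auto
  finally show ?thesis by simp
qed

lemma sum_diff_Suc_lessThan: "(\<Sum>r<k. k - 1 - r) = k * (k - 1) div (2::nat)"
proof (cases k)
  case (Suc l)
  then show ?thesis using sum_diff_lessThan[of l] by (simp add: mult.commute)
qed simp

lemma vtu_carrier [simp]: "vtu k v \<in> carrier_mat k k"
  by (simp add: vtu_def)

lemma vtsu_carrier [simp]: "vtsu k v \<in> carrier_mat k k"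
  by (simp add: vtsu_def)

lemma vtu_surj:
  assumes U: "U \<in> carrier_mat k k" and upper: "\<And>i j. j < i \<Longrightarrow> i < k \<Longrightarrow> U $$ (i, j) = 0"
  obtains v where "v \<in> carrier_vec (k * (k + 1) div 2)" "vtu k v = U"
proof -
  \<comment> \<open>Row \<open>i\<close> is read from the diagonal on, so its entry \<open>p\<close>
    lies in column \<open>i + p\<close>.\<close>
  obtain v where "v \<in> carrier_vec (\<Sum>r<k. k - r)"
    and v: "\<And>i p. i < k \<Longrightarrow> p < k - i \<Longrightarrow> v $ ((\<Sum>r<i. k - r) + p) = U $$ (i, i + p)"
    using rowwise_fill[of "\<lambda>r. k - r" k "\<lambda>i p. U $$ (i, i + p)"] by blast
  moreover have "vtu k v = U"
  proof (rule eq_matI)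
    fix i j assume "i < dim_row U" "j < dim_col U"
    then have ij: "i < k" "j < k" using U by auto
    show "vtu k v $$ (i, j) = U $$ (i, j)"
      using ij upper[of j i] v[of i "j - i"] by (cases "i \<le> j") (auto simp: vtu_def)
  qed (use U in \<open>auto simp: vtu_def\<close>)
  ultimately show ?thesis using that unfolding sum_diff_lessThan by blast
qed

lemma vtsu_surj:
  assumes U: "U \<in> carrier_mat k k" and upper: "\<And>i j. j \<le> i \<Longrightarrow> i < k \<Longrightarrow> U $$ (i, j) = 0"
  obtains v where "v \<in> carrier_vec (k * (k - 1) div 2)" "vtsu k v = U"
proof -
  \<comment> \<open>Each row now starts one column to the right of the diagonal, hence the extra
    \<open>Suc\<close>.\<close>
  obtain v where "v \<in> carrier_vec (\<Sum>r<k. k - 1 - r)"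
    and v: "\<And>i p. i < k \<Longrightarrow> p < k - 1 - i \<Longrightarrow>
      v $ ((\<Sum>r<i. k - 1 - r) + p) = U $$ (i, Suc (i + p))"
    using rowwise_fill[of "\<lambda>r. k - 1 - r" k "\<lambda>i p. U $$ (i, Suc (i + p))"] by blast
  moreover have "vtsu k v = U"
  proof (rule eq_matI)
    fix i j assume "i < dim_row U" "j < dim_col U"
    then have ij: "i < k" "j < k" using U by auto
    show "vtsu k v $$ (i, j) = U $$ (i, j)"
      using ij upper[of j i] v[of i "j - i - 1"] by (cases "i < j") (auto simp: vtsu_def)
  qed (use U in \<open>auto simp: vtsu_def\<close>)
  ultimately show ?thesis using that unfolding sum_diff_Suc_lessThan by blast
qed

text \<open>\<open>vtf\<close> recovers the number of rows by dividing the length by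
  \<open>m\<close>; this is where \<open>m \<ge> 1\<close> enters.\<close>

lemma vtf_carrier [simp]: "m \<ge> 1 \<Longrightarrow> v \<in> carrier_vec (n * m) \<Longrightarrow> vtf m v \<in> carrier_mat n m"
  by (auto simp: vtf_def)

lemma vtf_surj:
  assumes B: "B \<in> carrier_mat n m" and m: "m \<ge> 1"
  obtains v where "v \<in> carrier_vec (n * m)" "vtf m v = B"
proof (rule that)
  \<comment> \<open>Entry \<open>(i, j)\<close> is stored at \<open>j * n + i\<close>;
    \<open>mod\<close> and \<open>div\<close> by \<open>n\<close> recover \<open>i\<close> and
    \<open>j\<close>.\<close>
  let ?v = "vec (n * m) (\<lambda>p. B $$ (p mod n, p div n))"
  show "?v \<in> carrier_vec (n * m)" by simp
  have less: "j * n + i < n * m" if "i < n" "j < m" for i j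
  proof -
    have "j * n + i < Suc j * n" using that by simp
    also have "\<dots> \<le> m * n" using that by (intro mult_le_mono1) simp
    finally show ?thesis by (simp add: mult.commute)
  qed
  show "vtf m ?v = B"
    by (rule eq_matI) (use B m less in \<open>auto simp: vtf_def\<close>)
qed

lemma skew_of_vtsu_surj:
  fixes J :: "real mat"
  assumes J: "J \<in> carrier_mat k k" and skew: "J = - J\<^sup>T"
  obtains v where "v \<in> carrier_vec (k * (k - 1) div 2)" "J = (vtsu k v)\<^sup>T - vtsu k v"
proof -
  have J_skew: "J $$ (i, j) = - J $$ (j, i)" if "i < k" "j < k" for i j
    using that J arg_cong[OF skew, of "\<lambda>M. M $$ (i, j)"] by simp
  \<comment> \<open>Since \<open>U\<close> has a minus sign in \<open>U\<^sup>T - U\<close>, the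
    lower triangle of \<open>J\<close> is the one to store, transposed.\<close>
  define U where "U = mat k k (\<lambda>(i, j). if i < j then J $$ (j, i) else 0)"
  have "U \<in> carrier_mat k k" and "\<And>i j. j \<le> i \<Longrightarrow> i < k \<Longrightarrow> U $$ (i, j) = 0"
    by (auto simp: U_def)
  then obtain v where v: "v \<in> carrier_vec (k * (k - 1) div 2)" "vtsu k v = U"
    by (rule vtsu_surj)
  have "J = U\<^sup>T - U"
  proof (rule eq_matI)
    fix i j assume "i < dim_row (U\<^sup>T - U)" "j < dim_col (U\<^sup>T - U)"
    then have "i < k" "j < k" by (auto simp: U_def)
    then show "J $$ (i, j) = (U\<^sup>T - U) $$ (i, j)"
      \<comment> \<open>On the diagonal \<open>J_skew\<close> says that an entry equals its own
        negative, so it is 0.\<close>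
      using J_skew[of i j] by (cases i j rule: linorder_cases) (auto simp: U_def)
  qed (use J in \<open>auto simp: U_def\<close>)
  with v that show ?thesis by blast
qed

lemma skew_transpose_minus:
  fixes U :: "real mat"
  assumes "U \<in> carrier_mat k k"
  shows "U\<^sup>T - U = - (U\<^sup>T - U)\<^sup>T"
  by (rule eq_matI) (use assms in auto)

section \<open>Blocks and slices\<close>

text \<open>The rows of the two outer factors are unit vectors, so the product picks the rows
  \<open>f i\<close> and columns \<open>g j\<close> of \<open>W\<close>. The blocks
  \<open>R\<close>, \<open>P\<close> and \<open>S\<close> arise by taking the identity or the shift
  by \<open>n\<close> for \<open>f\<close> and \<open>g\<close>.\<close>

lemma selector_mult:
  fixes W :: "'a :: semiring_1 mat"
  assumes W: "W \<in> carrier_mat N N"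
    and f: "\<And>i. i < a \<Longrightarrow> f i < N" and g: "\<And>j. j < b \<Longrightarrow> g j < N"
  shows "mat a N (\<lambda>(i, j). if j = f i then 1 else 0) * W *
      (mat b N (\<lambda>(i, j). if j = g i then 1 else 0))\<^sup>T = mat a b (\<lambda>(i, j). W $$ (f i, g j))"
    (is "?F * W * ?G\<^sup>T = _")
proof -
  have FW: "?F * W = mat a N (\<lambda>(i, j). W $$ (f i, j))"
    by (rule eq_matI) (use W f in \<open>auto simp: scalar_prod_def if_distrib[of "\<lambda>x. x * z" for z] cong: if_cong\<close>)
  show ?thesis
    unfolding FW by (rule eq_matI)
      (use W f g in \<open>auto simp: scalar_prod_def if_distrib[of "\<lambda>x. z * x" for z] cong: if_cong\<close>)
qed

lemma one_append_cols_zero: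
  "1\<^sub>m n @\<^sub>c 0\<^sub>m n m = mat n (n + m) (\<lambda>(i, j). if j = i then 1 else 0)"
  by (rule eq_matI) (auto simp: append_cols_def)

lemma zero_append_cols_one:
  "0\<^sub>m m n @\<^sub>c 1\<^sub>m m = mat m (n + m) (\<lambda>(i, j). if j = n + i then 1 else 0)"
  by (rule eq_matI) (auto simp: append_cols_def)

lemma W_of_carrier: "W_of n m \<theta> \<in> carrier_mat (n + m) (n + m)"
  by (simp add: W_of_def)

lemma R_of_eq: "R_of n m \<theta> = mat n n (\<lambda>(i, j). W_of n m \<theta> $$ (i, j))"
  unfolding R_of_def one_append_cols_zero by (rule selector_mult[OF W_of_carrier]) auto

lemma P_of_eq: "P_of n m \<theta> = mat n m (\<lambda>(i, j). W_of n m \<theta> $$ (i, n + j))"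
  unfolding P_of_def one_append_cols_zero zero_append_cols_one
  by (rule selector_mult[OF W_of_carrier]) auto

lemma S_of_eq: "S_of n m \<theta> = mat m m (\<lambda>(i, j). W_of n m \<theta> $$ (n + i, n + j))"
  unfolding S_of_def zero_append_cols_one by (rule selector_mult[OF W_of_carrier]) auto

lemma symmetric_psd_W_of: "symmetric_psd (n + m) (W_of n m \<theta>)"
  unfolding W_of_def by (rule symmetric_psd_transpose_mult_self) simp

text \<open>Cutting \<open>W_of\<close> into blocks and gluing them again loses nothing: the lower
  left block is rebuilt as the transpose of \<open>P\<close>, which is correct because
  \<open>W_of\<close> is symmetric.\<close>

lemma sys_W_Sigma_pH: "sys_W (Sigma_pH n m \<theta>) = W_of n m \<theta>"
proof -
  let ?W = "W_of n m \<theta>"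
  have "?W\<^sup>T = ?W" using symmetric_psd_W_of by (simp add: symmetric_psd_def)
  then have sym: "?W $$ (i, j) = ?W $$ (j, i)" if "i < n + m" "j < n + m" for i j
    using that W_of_carrier[of n m \<theta>] by (metis carrier_matD index_transpose_mat(1))
  show ?thesis
  proof (rule eq_matI)
    fix i j assume "i < dim_row ?W" "j < dim_col ?W"
    then have "i < n + m" "j < n + m" using W_of_carrier[of n m \<theta>] by auto
    then show "sys_W (Sigma_pH n m \<theta>) $$ (i, j) = ?W $$ (i, j)"
      using sym[of i j]
      by (auto simp: sys_W_def Sigma_pH_def R_of_eq P_of_eq S_of_eq not_less)
  qed (use W_of_carrier[of n m \<theta>] in \<open>auto simp: sys_W_def Sigma_pH_def R_of_eq S_of_eq\<close>)
qed

section \<open>The structural constraints, and recovery of the parameter vector\<close>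

lemma port_Hamiltonian_Sigma_pH:
  assumes "m \<ge> 1"
  shows "port_Hamiltonian n m (Sigma_pH n m \<theta>)"
proof -
  have "E_of n m \<theta> \<in> carrier_mat n n" "symmetric_psd n (E_of n m \<theta>)"
    by (simp_all add: E_of_def symmetric_psd_transpose_mult_self)
  moreover have "J_of n m \<theta> \<in> carrier_mat n n" "J_of n m \<theta> = - (J_of n m \<theta>)\<^sup>T"
    using skew_transpose_minus[of _ n] unfolding J_of_def
    by (auto intro!: minus_carrier_mat)
  moreover have "N_of n m \<theta> \<in> carrier_mat m m" "N_of n m \<theta> = - (N_of n m \<theta>)\<^sup>T"
    using skew_transpose_minus[of _ m] unfolding N_of_def
    by (auto intro!: minus_carrier_mat)
  moreover have "B_of n m \<theta> \<in> carrier_mat n m"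
    using assms by (simp add: B_of_def theta_B_def slice_def len_B_def)
  moreover have "symmetric_psd (n + m) (sys_W (Sigma_pH n m \<theta>))"
    unfolding sys_W_Sigma_pH by (rule symmetric_psd_W_of)
  ultimately show ?thesis
    unfolding port_Hamiltonian_def
    by (simp add: Sigma_pH_def R_of_eq P_of_eq S_of_eq)
qed

text \<open>Slicing undoes concatenation, so the five blocks of parameters can be chosen
  independently.\<close>

lemma exists_theta:
  assumes E: "vE \<in> carrier_vec (len_E n)" and J: "vJ \<in> carrier_vec (len_J n)"
    and W: "vW \<in> carrier_vec (len_W n m)" and B: "vB \<in> carrier_vec (len_B n m)"
    and N: "vN \<in> carrier_vec (len_N m)"
  obtains \<theta> where "\<theta> \<in> carrier_vec (n_theta n m)" "theta_E n m \<theta> = vE" "theta_J n m \<theta> = vJ"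
    "theta_W n m \<theta> = vW" "theta_B n m \<theta> = vB" "theta_N n m \<theta> = vN"
proof (rule that)
  let ?\<theta> = "vE @\<^sub>v vJ @\<^sub>v vW @\<^sub>v vB @\<^sub>v vN"
  note defs = theta_E_def theta_J_def theta_W_def theta_B_def theta_N_def slice_def
  note dims = E[THEN carrier_vecD] J[THEN carrier_vecD] W[THEN carrier_vecD]
    B[THEN carrier_vecD] N[THEN carrier_vecD]
  show "?\<theta> \<in> carrier_vec (n_theta n m)"
    by (rule carrier_vecI) (simp add: dims n_theta_partition)
  show "theta_E n m ?\<theta> = vE" "theta_J n m ?\<theta> = vJ" "theta_W n m ?\<theta> = vW"
    "theta_B n m ?\<theta> = vB" "theta_N n m ?\<theta> = vN"
    by (rule eq_vecI; simp add: defs dims)+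
qed

lemma port_Hamiltonian_imp_Sigma_pH:
  assumes m: "m \<ge> 1" and pH: "port_Hamiltonian n m \<Sigma>"
  obtains \<theta> where "\<theta> \<in> carrier_vec (n_theta n m)" "\<Sigma> = Sigma_pH n m \<theta>"
proof -
  note pH = pH[unfolded port_Hamiltonian_def]
  obtain UE where "UE \<in> carrier_mat n n" "\<And>i j. j < i \<Longrightarrow> i < n \<Longrightarrow> UE $$ (i, j) = 0"
    and E: "sys_E \<Sigma> = UE\<^sup>T * UE"
    using pH cholesky_psd by metis
  then obtain vE where vE: "vE \<in> carrier_vec (len_E n)" "vtu n vE = UE"
    unfolding len_E_def by (metis vtu_surj)
  \<comment> \<open>\<open>R\<close>, \<open>P\<close> and \<open>S\<close> are not factored
    separately; one factorisation of the joint matrix yields parameters for all three.\<close>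
  obtain UW where "UW \<in> carrier_mat (n + m) (n + m)"
      "\<And>i j. j < i \<Longrightarrow> i < n + m \<Longrightarrow> UW $$ (i, j) = 0"
    and W: "sys_W \<Sigma> = UW\<^sup>T * UW"
    using pH cholesky_psd by metis
  then obtain vW where vW: "vW \<in> carrier_vec (len_W n m)" "vtu (n + m) vW = UW"
    unfolding len_W_def by (metis vtu_surj)
  obtain vJ where vJ: "vJ \<in> carrier_vec (len_J n)" "sys_J \<Sigma> = (vtsu n vJ)\<^sup>T - vtsu n vJ"
    using pH skew_of_vtsu_surj unfolding len_J_def by metis
  obtain vN where vN: "vN \<in> carrier_vec (len_N m)" "sys_N \<Sigma> = (vtsu m vN)\<^sup>T - vtsu m vN"
    using pH skew_of_vtsu_surj unfolding len_N_def by metis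
  obtain vB where vB: "vB \<in> carrier_vec (len_B n m)" "vtf m vB = sys_B \<Sigma>"
    using pH m vtf_surj unfolding len_B_def by metis
  obtain \<theta> where \<theta>: "\<theta> \<in> carrier_vec (n_theta n m)" and parts: "theta_E n m \<theta> = vE"
    "theta_J n m \<theta> = vJ" "theta_W n m \<theta> = vW" "theta_B n m \<theta> = vB" "theta_N n m \<theta> = vN"
    by (rule exists_theta[OF vE(1) vJ(1) vW(1) vB(1) vN(1)])
  \<comment> \<open>By \<open>R_of_eq\<close>, \<open>P_of_eq\<close> and \<open>S_of_eq\<close>,
    equality of the joint matrices settles the three blocks below.\<close>
  have W_eq: "W_of n m \<theta> = sys_W \<Sigma>" by (simp add: W_of_def parts vW W)
  have "\<Sigma> = Sigma_pH n m \<theta>"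
  proof (rule system.equality)
    show "sys_R \<Sigma> = sys_R (Sigma_pH n m \<theta>)"
      by (rule eq_matI) (use pH in \<open>auto simp: Sigma_pH_def R_of_eq W_eq sys_W_def\<close>)
    show "sys_P \<Sigma> = sys_P (Sigma_pH n m \<theta>)"
      by (rule eq_matI) (use pH in \<open>auto simp: Sigma_pH_def P_of_eq W_eq sys_W_def\<close>)
    show "sys_S \<Sigma> = sys_S (Sigma_pH n m \<theta>)"
      by (rule eq_matI) (use pH in \<open>auto simp: Sigma_pH_def S_of_eq W_eq sys_W_def\<close>)
  qed (simp_all add: Sigma_pH_def E_of_def J_of_def B_of_def N_of_def parts vE E vJ vB vN)
  with \<theta> that show ?thesis by blast
qed

theorem lemma4:
  fixes n m :: nat
  assumes "n \<ge> 1" and "m \<ge> 1"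
  shows "(\<forall>\<theta> \<in> carrier_vec (n_theta n m). port_Hamiltonian n m (Sigma_pH n m \<theta>)) \<and>
    (\<forall>\<Sigma> :: system. port_Hamiltonian n m \<Sigma> \<longrightarrow>
       (\<exists>\<theta> \<in> carrier_vec (n_theta n m). \<Sigma> = Sigma_pH n m \<theta>))"
  using assms port_Hamiltonian_Sigma_pH port_Hamiltonian_imp_Sigma_pH by blast

end
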